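(* For $\varepsilon\in(0,\varepsilon^*]$ let $\mathcal A_\varepsilon$ be the numerical attractor of the implicit Euler scheme $u_n^\varepsilon=u_{n-1}^\varepsilon+\varepsilon Fu_n^\varepsilon$, and let $\mathcal A$ be the global attractor of the lattice system $\frac{du}{dt}=Fu$ in $\ell^2$. Then $$\lim_{\varepsilon\to0^+}d_{\ell^2}(\mathcal A_\varepsilon,\mathcal A)=0.$$ Moreover, $\mathcal A_\varepsilon$ is upper semicontinuous on $(0,\varepsilon^*]$: $$\lim_{\varepsilon\to\varepsilon_0}d_{\ell^2}(\mathcal A_\varepsilon,\mathcal A_{\varepsilon_0})=0,\qquad\forall\,\varepsilon_0\in(0,\varepsilon^*].$$
   Context: $\ell^2$ is the complex Hilbert space of square-summable sequences $u=(u_j)_{j\in\mathbb Z}$, $u_j\in\mathbb C$, with norm $\|\cdot\|$; $\|u\|_q^q=\sum_j|u_j|^q$. $\Lambda:\ell^2\to\ell^2$ is $(\Lambda u)_j=-u_{j-1}+2u_j-u_{j+1}$. Parameters: $\lambda,\gamma,k,p>0$, $\mu,\beta,\nu\in\mathbb R$, with $\gamma>4\lambda$; $g=(g_j)_{j\in\mathbb Z}$ is a fixed complex sequence with $\|g\|_{(p+2)/(p+1)}<\infty$ (hence $g\in\ell^2$). The vector field is $$Fu=(\lambda+i\mu)\Lambda u-(\gamma+i\beta)u-(k+i\nu)|u|^pu+g,\qquad |u|^pu=(|u_j|^pu_j)_{j\in\mathbb Z}.$$ $B_r=\{u\in\ell^2:\|u\|\le r\}$. $C_p>0$ is a constant depending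 only on $p$ such that $\||u|^pu-|v|^pv\|\le C_pr^p\|u-v\|$ for all $r>0$ and $u,v\in B_r$. For $r>0$, $M_r=(4\lambda+4|\mu|+\gamma+|\beta|)r+(k+|\nu|)r^{p+1}+\|g\|$ and $L_r=4\lambda+4|\mu|+\gamma+|\beta|+C_pr^p(k+|\nu|)$. Fix $\eta\ge0$ and set $$c_1=\frac{p+1}{p+2}\,\frac{1}{[k(p+2)]^{1/(p+1)}}\,\|g\|_{\frac{p+2}{p+1}}^{\frac{p+2}{p+1}},\quad r^*=\sqrt{\eta+\frac{c_1}{\gamma-4\lambda}},\quad \varepsilon^*=\min\Big\{\frac1{M_{r^*+1}},\frac1{1+L_{r^*+1}}\Big\}.$$ The Hausdorff semi-distance is $d_{\ell^2}(A,B)=\sup_{a\in A}\inf_{b\in B}\|a-b\|$. For $u_0\in\ell^2$, $u(t,u_0)$, $t\ge0$, is the unique global solution of $\frac{du}{dt}=Fu$, $u(0)=u_0$. The global attractor $\mathcal A$ is the unique compact set in $\ell^2$ with $u(t,\mathcal A)=\mathcal A$ for all $t\ge0$ and $\lim_{t\to\infty}d_{\ell^2}(u(t,B_r),\mathcal A)=0$ for all $r>0$. For $\varepsilon\in(0,\varepsilon^*]$ and $y\in B_{r^*}$ the scheme with $u_0^\varepsilon=y$ has a unique solution $u_n^\varepsilon(y)\in B_{r^*}$, $n\in\mathbb N$; set $S_\varepsilon(n)y=u_n^\varepsilon(y)$. The numerical attractor $\mathcal A_\varepsilon$ is the unique compact subset of $B_{r^*}$ with $S_\varepsilon(n)\mathcal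 A_\varepsilon=\mathcal A_\varepsilon$ for all $n\in\mathbb N$ and $\lim_{n\to\infty}d_{\ell^2}(S_\varepsilon(n)B_{r^*},\mathcal A_\varepsilon)=0$; explicitly $\mathcal A_\varepsilon=\bigcap_{m\in\mathbb N}\overline{\bigcup_{n\ge m}S_\varepsilon(n)B_{r^*}}$. *)

theory Defs
  imports "HOL-Analysis.Analysis"
begin

section \<open>The complex Hilbert space of square-summable bi-infinite sequences\<close>

typedef ell2 = "{u :: int \<Rightarrow> complex. (\<lambda>j. (cmod (u j))\<^sup>2) summable_on UNIV}"
  morphisms coord Abs_ell2
  by (rule exI[of _ "\<lambda>_. 0"]) simp

setup_lifting type_definition_ell2

lemma coord_summable: "(\<lambda>j. (cmod (coord u j))\<^sup>2) summable_on A"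
  using coord[of u] summable_on_subset by (auto intro: summable_on_subset_banach)

lemma ell2_eqI: "(\<And>j. coord u j = coord v j) \<Longrightarrow> u = v"
  by (simp add: coord_inject[symmetric] ext)

lemma coord_Abs_ell2:
  "(\<lambda>j. (cmod (f j))\<^sup>2) summable_on UNIV \<Longrightarrow> coord (Abs_ell2 f) = f"
  by (simp add: Abs_ell2_inverse)

lemma square_summable_add:
  fixes f g :: "int \<Rightarrow> complex"
  assumes "(\<lambda>j. (cmod (f j))\<^sup>2) summable_on UNIV" "(\<lambda>j. (cmod (g j))\<^sup>2) summable_on UNIV"
  shows "(\<lambda>j. (cmod (f j + g j))\<^sup>2) summable_on UNIV"
proof (rule summable_on_comparison_test)
  show "(\<lambda>j. 2 * (cmod (f j))\<^sup>2 + 2 * (cmod (g j))\<^sup>2) summable_on UNIV"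
    by (intro summable_on_add summable_on_cmult_right assms)
  show "(cmod (f j + g j))\<^sup>2 \<le> 2 * (cmod (f j))\<^sup>2 + 2 * (cmod (g j))\<^sup>2" for j
  proof -
    have "(cmod (f j + g j))\<^sup>2 \<le> (cmod (f j) + cmod (g j))\<^sup>2"
      by (intro power_mono norm_triangle_ineq) auto
    also have "\<dots> \<le> 2 * (cmod (f j))\<^sup>2 + 2 * (cmod (g j))\<^sup>2"
      using sum_squares_bound[of "cmod (f j)" "cmod (g j)"] by (simp add: power2_sum)
    finally show ?thesis .
  qed
qed auto

lemma square_summable_mult:
  fixes f :: "int \<Rightarrow> complex"
  assumes "(\<lambda>j. (cmod (f j))\<^sup>2) summable_on UNIV"
  shows "(\<lambda>j. (cmod (c * f j))\<^sup>2) summable_on UNIV"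
  using summable_on_cmult_right[OF assms, of "(cmod c)\<^sup>2"]
  by (simp add: norm_mult power_mult_distrib)

lemma square_summable_shift:
  fixes f :: "int \<Rightarrow> complex"
  assumes "(\<lambda>j. (cmod (f j))\<^sup>2) summable_on UNIV"
  shows "(\<lambda>j. (cmod (f (j + m)))\<^sup>2) summable_on UNIV"
proof -
  have "bij_betw (\<lambda>j::int. j + m) UNIV UNIV"
    by (rule bij_betwI[of _ _ _ "\<lambda>j. j - m"]) auto
  from summable_on_reindex_bij_betw[OF this, of "\<lambda>j. (cmod (f j))\<^sup>2"] assms show ?thesis
    by simp
qed

instantiation ell2 :: real_vector
begin

lift_definition zero_ell2 :: ell2 is "\<lambda>_. 0" by simp

lift_definition plus_ell2 :: "ell2 \<Rightarrow> ell2 \<Rightarrow> ell2" is "\<lambda>u v j. u j + v j"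
  by (rule square_summable_add)

lift_definition uminus_ell2 :: "ell2 \<Rightarrow> ell2" is "\<lambda>u j. - u j" by simp

lift_definition scaleR_ell2 :: "real \<Rightarrow> ell2 \<Rightarrow> ell2" is "\<lambda>r u j. complex_of_real r * u j"
  by (rule square_summable_mult)

definition minus_ell2 :: "ell2 \<Rightarrow> ell2 \<Rightarrow> ell2" where "minus_ell2 u v = u + (- v)"

instance
  by standard
    ((rule minus_ell2_def | transfer, force simp: fun_eq_iff algebra_simps)+)

end

lemma coord_zero [simp]: "coord 0 j = 0" by transfer simp
lemma coord_add [simp]: "coord (u + v) j = coord u j + coord v j" by transfer simp
lemma coord_uminus [simp]: "coord (- u) j = - coord u j" by transfer simp
lemma coord_diff [simp]: "coord (u - v) j = coord u j - coord v j"
  by (simp add: minus_ell2_def del: add_uminus_conv_diff)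
lemma coord_scaleR [simp]: "coord (r *\<^sub>R u) j = complex_of_real r * coord u j"
  by transfer simp

lemma coord_inner_summable: "(\<lambda>j. coord u j \<bullet> coord v j) summable_on UNIV"
proof -
  have "(\<lambda>j. norm (coord u j \<bullet> coord v j)) summable_on UNIV"
  proof (rule summable_on_comparison_test)
    show "(\<lambda>j. (cmod (coord u j))\<^sup>2 + (cmod (coord v j))\<^sup>2) summable_on UNIV"
      by (intro summable_on_add coord_summable)
    show "norm (coord u j \<bullet> coord v j) \<le> (cmod (coord u j))\<^sup>2 + (cmod (coord v j))\<^sup>2" for j
    proof -
      have "norm (coord u j \<bullet> coord v j) \<le> cmod (coord u j) * cmod (coord v j)"
        using Cauchy_Schwarz_ineq2[of "coord u j" "coord v j"] by simp
      moreover have "2 * (cmod (coord u j) * cmod (coord v j))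
          \<le> (cmod (coord u j))\<^sup>2 + (cmod (coord v j))\<^sup>2"
        using sum_squares_bound[of "cmod (coord u j)" "cmod (coord v j)"]
        by (simp add: mult.assoc)
      moreover have "0 \<le> cmod (coord u j) * cmod (coord v j)" by simp
      ultimately show ?thesis by linarith
    qed
  qed auto
  then show ?thesis by (rule abs_summable_summable)
qed

text \<open>The class \<^class>\<open>real_inner\<close> asks for a real inner product: it is the real part of the
  complex inner product of the sequences, and induces the same norm.\<close>

instantiation ell2 :: real_inner
begin

definition inner_ell2 :: "ell2 \<Rightarrow> ell2 \<Rightarrow> real"
  where "inner_ell2 u v = (\<Sum>\<^sub>\<infinity>j. coord u j \<bullet> coord v j)"

definition norm_ell2 :: "ell2 \<Rightarrow> real"
  where "norm_ell2 u = sqrt (\<Sum>\<^sub>\<infinity>j. (cmod (coord u j))\<^sup>2)"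

definition sgn_ell2 :: "ell2 \<Rightarrow> ell2" where "sgn_ell2 u = u /\<^sub>R norm u"

definition dist_ell2 :: "ell2 \<Rightarrow> ell2 \<Rightarrow> real" where "dist_ell2 u v = norm (u - v)"

definition uniformity_ell2 :: "(ell2 \<times> ell2) filter"
  where "uniformity_ell2 = (INF e\<in>{0<..}. principal {(u, v). dist u v < e})"

definition open_ell2 :: "ell2 set \<Rightarrow> bool"
  where "open_ell2 U \<longleftrightarrow> (\<forall>x\<in>U. eventually (\<lambda>(x', y). x' = x \<longrightarrow> y \<in> U) uniformity)"

instance
proof
  fix u v w :: ell2 and r :: real
  show "u \<bullet> v = v \<bullet> u"
    unfolding inner_ell2_def by (subst inner_commute) (rule refl)
  show "(u + v) \<bullet> w = u \<bullet> w + v \<bullet> w"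
    by (simp add: inner_ell2_def inner_add_left infsum_add coord_inner_summable)
  have "(complex_of_real r * x) \<bullet> y = r * (x \<bullet> y)" for x y
    by (simp add: inner_complex_def algebra_simps)
  then show "(r *\<^sub>R u) \<bullet> v = r * (u \<bullet> v)"
    by (simp add: inner_ell2_def infsum_cmult_right')
  show "0 \<le> u \<bullet> u"
    by (simp add: inner_ell2_def infsum_nonneg)
  show "u \<bullet> u = 0 \<longleftrightarrow> u = 0"
  proof
    assume "u \<bullet> u = 0"
    then have "coord u j \<bullet> coord u j = 0" for j
      using nonneg_infsum_le_0D[of "\<lambda>j. coord u j \<bullet> coord u j" UNIV j]
        coord_inner_summable[of u u] by (simp add: inner_ell2_def)
    then show "u = 0" by (intro ell2_eqI) simp
  qed (simp add: inner_ell2_def)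
  show "norm u = sqrt (u \<bullet> u)"
    by (simp only: norm_ell2_def inner_ell2_def power2_norm_eq_inner)
qed (simp_all add: sgn_ell2_def dist_ell2_def uniformity_ell2_def open_ell2_def)

end

lemma norm_ell2_sq: "(norm u)\<^sup>2 = (\<Sum>\<^sub>\<infinity>j. (cmod (coord u j))\<^sup>2)" for u :: ell2
  by (simp add: norm_ell2_def infsum_nonneg)

lemma sum_coord_le: "finite A \<Longrightarrow> (\<Sum>j\<in>A. (cmod (coord u j))\<^sup>2) \<le> (norm u)\<^sup>2"
  unfolding norm_ell2_sq by (rule finite_sum_le_infsum[OF coord_summable]) auto

lemma coord_le_norm: "cmod (coord u j) \<le> norm u"
  by (rule power2_le_imp_le) (use sum_coord_le[of "{j}" u] in auto)

instance ell2 :: complete_space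
proof
  fix X :: "nat \<Rightarrow> ell2"
  assume X: "Cauchy X"
  have "Cauchy (\<lambda>n. coord (X n) j)" for j
  proof (rule metric_CauchyI)
    fix e :: real assume "0 < e"
    then obtain N where N: "\<And>m n. m \<ge> N \<Longrightarrow> n \<ge> N \<Longrightarrow> dist (X m) (X n) < e"
      using metric_CauchyD[OF X] by blast
    have "dist (coord (X m) j) (coord (X n) j) \<le> dist (X m) (X n)" for m n
      using coord_le_norm[of "X m - X n" j] by (simp add: dist_norm)
    then show "\<exists>N. \<forall>m\<ge>N. \<forall>n\<ge>N. dist (coord (X m) j) (coord (X n) j) < e"
      using N by (meson le_less_trans)
  qed
  then have "\<exists>l. (\<lambda>n. coord (X n) j) \<longlonglongrightarrow> l" for j
    using Cauchy_convergent convergent_def by blast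
  then obtain f where f: "\<And>j. (\<lambda>n. coord (X n) j) \<longlonglongrightarrow> f j"
    by metis
  have bound: "\<exists>N. \<forall>m\<ge>N. \<forall>A. finite A \<longrightarrow> (\<Sum>j\<in>A. (cmod (coord (X m) j - f j))\<^sup>2) \<le> e\<^sup>2"
    if e: "0 < e" for e
  proof -
    obtain N where N: "\<And>m n. m \<ge> N \<Longrightarrow> n \<ge> N \<Longrightarrow> dist (X m) (X n) < e"
      using metric_CauchyD[OF X e] by blast
    have "(\<Sum>j\<in>A. (cmod (coord (X m) j - f j))\<^sup>2) \<le> e\<^sup>2" if m: "m \<ge> N" and "finite A" for m A
    proof (rule LIMSEQ_le_const2)
      show "(\<lambda>n. \<Sum>j\<in>A. (cmod (coord (X m) j - coord (X n) j))\<^sup>2)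
          \<longlonglongrightarrow> (\<Sum>j\<in>A. (cmod (coord (X m) j - f j))\<^sup>2)"
        by (intro tendsto_intros f)
      have "(\<Sum>j\<in>A. (cmod (coord (X m) j - coord (X n) j))\<^sup>2) \<le> e\<^sup>2" if "n \<ge> N" for n
      proof -
        have "(\<Sum>j\<in>A. (cmod (coord (X m) j - coord (X n) j))\<^sup>2) \<le> (norm (X m - X n))\<^sup>2"
          using sum_coord_le[OF \<open>finite A\<close>, of "X m - X n"] by simp
        also have "\<dots> \<le> e\<^sup>2"
          using N[OF m that] by (intro power_mono) (auto simp: dist_norm)
        finally show ?thesis .
      qed
      then show "\<exists>N. \<forall>n\<ge>N. (\<Sum>j\<in>A. (cmod (coord (X m) j - coord (X n) j))\<^sup>2) \<le> e\<^sup>2"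
        by blast
    qed
    then show ?thesis by blast
  qed
  obtain M where M: "\<And>A. finite A \<Longrightarrow> (\<Sum>j\<in>A. (cmod (coord (X M) j - f j))\<^sup>2) \<le> 1"
    using bound[of 1] by auto
  have "(\<lambda>j. (cmod (coord (X M) j - f j))\<^sup>2) summable_on UNIV"
    by (rule nonneg_bdd_above_summable_on) (auto intro!: bdd_aboveI[of _ 1] M)
  then have "(\<lambda>j. (cmod (- 1 * (coord (X M) j - f j)))\<^sup>2) summable_on UNIV"
    by (rule square_summable_mult)
  from square_summable_add[OF coord_summable[of "X M"] this]
  have cf: "coord (Abs_ell2 f) = f" by (intro coord_Abs_ell2) simp
  have "X \<longlonglongrightarrow> Abs_ell2 f"
  proof (rule metric_LIMSEQ_I)
    fix e :: real assume "0 < e"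
    then obtain N where N: "\<And>m A. m \<ge> N \<Longrightarrow> finite A \<Longrightarrow>
        (\<Sum>j\<in>A. (cmod (coord (X m) j - f j))\<^sup>2) \<le> (e / 2)\<^sup>2"
      using bound[of "e / 2"] by auto
    have "dist (X m) (Abs_ell2 f) < e" if "m \<ge> N" for m
    proof -
      have "(norm (X m - Abs_ell2 f))\<^sup>2 \<le> (e / 2)\<^sup>2"
        unfolding norm_ell2_sq
      proof (rule infsum_le_finite_sums[OF coord_summable])
        fix A :: "int set" assume "finite A"
        show "(\<Sum>j\<in>A. (cmod (coord (X m - Abs_ell2 f) j))\<^sup>2) \<le> (e / 2)\<^sup>2"
          using N[OF that \<open>finite A\<close>] by (simp add: cf)
      qed
      then have "norm (X m - Abs_ell2 f) \<le> e / 2"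
        by (rule power2_le_imp_le) (use \<open>0 < e\<close> in auto)
      then show ?thesis using \<open>0 < e\<close> by (simp add: dist_norm)
    qed
    then show "\<exists>N. \<forall>n\<ge>N. dist (X n) (Abs_ell2 f) < e" by blast
  qed
  then show "convergent X" by (rule convergentI)
qed

instance ell2 :: banach ..

lift_definition scaleC :: "complex \<Rightarrow> ell2 \<Rightarrow> ell2" (infixr "*\<^sub>C" 75) is "\<lambda>c u j. c * u j"
  by (rule square_summable_mult)

lemma coord_scaleC [simp]: "coord (c *\<^sub>C u) j = c * coord u j"
  by transfer simp

definition q_summable :: "real \<Rightarrow> ell2 \<Rightarrow> bool"
  where "q_summable q u \<longleftrightarrow> (\<lambda>j. cmod (coord u j) powr q) summable_on UNIV"

definition q_norm :: "real \<Rightarrow> ell2 \<Rightarrow> real"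
  where "q_norm q u = (\<Sum>\<^sub>\<infinity>j. cmod (coord u j) powr q) powr (1 / q)"

text \<open>A sequence with finite \<open>q\<close>-norm for some \<open>0 < q \<le> 2\<close> is square-summable, so no
  generality is lost by imposing \<^const>\<open>q_summable\<close> only on elements of \<^typ>\<open>ell2\<close>.\<close>

lemma q_summable_imp_ell2:
  fixes g :: "int \<Rightarrow> complex"
  assumes q: "0 < q" "q \<le> 2" and g: "(\<lambda>j. cmod (g j) powr q) summable_on UNIV"
  shows "coord (Abs_ell2 g) = g" "q_summable q (Abs_ell2 g)"
proof -
  define S where "S = (\<Sum>\<^sub>\<infinity>j. cmod (g j) powr q)"
  define K where "K = S powr (1 / q)"
  have S: "cmod (g j) powr q \<le> S" for j
    using finite_sum_le_infsum[OF g, of "{j}"] by (simp add: S_def)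
  have K: "cmod (g j) \<le> K" for j
  proof -
    have "(cmod (g j) powr q) powr (1 / q) \<le> K"
      unfolding K_def using S[of j] q by (intro powr_mono2) auto
    then show ?thesis using q by (simp add: powr_powr)
  qed
  have "(\<lambda>j. (cmod (g j))\<^sup>2) summable_on UNIV"
  proof (rule summable_on_comparison_test)
    show "(\<lambda>j. K powr (2 - q) * cmod (g j) powr q) summable_on UNIV"
      by (intro summable_on_cmult_right g)
    show "(cmod (g j))\<^sup>2 \<le> K powr (2 - q) * cmod (g j) powr q" for j
    proof (cases "g j = 0")
      case False
      then have "(cmod (g j))\<^sup>2 = cmod (g j) powr (2 - q) * cmod (g j) powr q"
        by (simp flip: powr_add)
      also have "\<dots> \<le> K powr (2 - q) * cmod (g j) powr q"
        using K[of j] q by (intro mult_right_mono powr_mono2) auto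
      finally show ?thesis .
    qed simp
  qed auto
  then show *: "coord (Abs_ell2 g) = g" by (rule coord_Abs_ell2)
  show "q_summable q (Abs_ell2 g)" by (simp add: q_summable_def * g)
qed

section \<open>The lattice vector field\<close>

lift_definition lattice_op :: "ell2 \<Rightarrow> ell2" is "\<lambda>u j. - u (j - 1) + 2 * u j - u (j + 1)"
proof -
  fix u :: "int \<Rightarrow> complex"
  assume u: "(\<lambda>j. (cmod (u j))\<^sup>2) summable_on UNIV"
  have "(\<lambda>j. (cmod ((- 1 * u (j + - 1) + 2 * u j) + - 1 * u (j + 1)))\<^sup>2) summable_on UNIV"
    by (rule square_summable_add[OF square_summable_add])
      (rule square_summable_mult square_summable_shift u)+
  then show "(\<lambda>j. (cmod (- u (j - 1) + 2 * u j - u (j + 1)))\<^sup>2) summable_on UNIV"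
    by simp
qed

lemma coord_lattice_op:
  "coord (lattice_op u) j = - coord u (j - 1) + 2 * coord u j - coord u (j + 1)"
  by transfer simp

text \<open>The sequence \<open>|u|\<^sup>pu\<close>; for \<open>p \<ge> 0\<close> it is square-summable by \<open>coord_power_nl\<close> below, so
  that \<^const>\<open>Abs_ell2\<close> is applied to an element of its domain.\<close>

definition power_nl :: "real \<Rightarrow> ell2 \<Rightarrow> ell2"
  where "power_nl p u = Abs_ell2 (\<lambda>j. complex_of_real (cmod (coord u j) powr p) * coord u j)"

lemma coord_power_nl:
  assumes "0 \<le> p"
  shows "coord (power_nl p u) j = complex_of_real (cmod (coord u j) powr p) * coord u j"
proof -
  have "(\<lambda>j. (cmod (complex_of_real (cmod (coord u j) powr p) * coord u j))\<^sup>2) summable_on UNIV"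
  proof (rule summable_on_comparison_test)
    show "(\<lambda>j. (norm u powr p)\<^sup>2 * (cmod (coord u j))\<^sup>2) summable_on UNIV"
      by (intro summable_on_cmult_right coord_summable)
    show "(cmod (complex_of_real (cmod (coord u j) powr p) * coord u j))\<^sup>2
        \<le> (norm u powr p)\<^sup>2 * (cmod (coord u j))\<^sup>2" for j
      unfolding norm_mult power_mult_distrib
      by (intro mult_right_mono power_mono)
        (auto intro!: powr_mono2 assms coord_le_norm)
  qed auto
  then show ?thesis by (simp add: power_nl_def coord_Abs_ell2)
qed

definition vector_field ::
    "real \<Rightarrow> real \<Rightarrow> real \<Rightarrow> real \<Rightarrow> real \<Rightarrow> real \<Rightarrow> real \<Rightarrow> ell2 \<Rightarrow> ell2 \<Rightarrow> ell2"
  where "vector_field l \<mu> \<gamma> \<beta> k \<nu> p g u =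
    Complex l \<mu> *\<^sub>C lattice_op u - Complex \<gamma> \<beta> *\<^sub>C u - Complex k \<nu> *\<^sub>C power_nl p u + g"

section \<open>Constants\<close>

definition M_const ::
    "real \<Rightarrow> real \<Rightarrow> real \<Rightarrow> real \<Rightarrow> real \<Rightarrow> real \<Rightarrow> real \<Rightarrow> ell2 \<Rightarrow> real \<Rightarrow> real"
  where "M_const l \<mu> \<gamma> \<beta> k \<nu> p g r =
    (4 * l + 4 * \<bar>\<mu>\<bar> + \<gamma> + \<bar>\<beta>\<bar>) * r + (k + \<bar>\<nu>\<bar>) * r powr (p + 1) + norm g"

definition L_const ::
    "real \<Rightarrow> real \<Rightarrow> real \<Rightarrow> real \<Rightarrow> real \<Rightarrow> real \<Rightarrow> real \<Rightarrow> real \<Rightarrow> real \<Rightarrow> real"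
  where "L_const l \<mu> \<gamma> \<beta> k \<nu> p Cp r =
    4 * l + 4 * \<bar>\<mu>\<bar> + \<gamma> + \<bar>\<beta>\<bar> + Cp * r powr p * (k + \<bar>\<nu>\<bar>)"

definition c1_const :: "real \<Rightarrow> real \<Rightarrow> ell2 \<Rightarrow> real"
  where "c1_const k p g =
    (p + 1) / (p + 2) * (1 / (k * (p + 2)) powr (1 / (p + 1)))
      * q_norm ((p + 2) / (p + 1)) g powr ((p + 2) / (p + 1))"

definition r_star :: "real \<Rightarrow> real \<Rightarrow> real \<Rightarrow> real \<Rightarrow> ell2 \<Rightarrow> real \<Rightarrow> real"
  where "r_star l \<gamma> k p g \<eta> = sqrt (\<eta> + c1_const k p g / (\<gamma> - 4 * l))"

definition eps_star ::
    "real \<Rightarrow> real \<Rightarrow> real \<Rightarrow> real \<Rightarrow> real \<Rightarrow> real \<Rightarrow> real \<Rightarrow> ell2 \<Rightarrow> real \<Rightarrow> real \<Rightarrow> real"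
  where "eps_star l \<mu> \<gamma> \<beta> k \<nu> p g Cp \<eta> =
    (let r = r_star l \<gamma> k p g \<eta>
     in min (1 / M_const l \<mu> \<gamma> \<beta> k \<nu> p g (r + 1))
            (1 / (1 + L_const l \<mu> \<gamma> \<beta> k \<nu> p Cp (r + 1))))"

section \<open>Solutions and attractors\<close>

text \<open>Values in \<^typ>\<open>ennreal\<close> make the semi-distance of a nonempty set to the empty set
  infinite, so that the empty set attracts no nonempty set, and keep the supremum meaningful
  on unbounded sets.\<close>

definition hausdorff_semidist :: "'a::metric_space set \<Rightarrow> 'a set \<Rightarrow> ennreal"
  where "hausdorff_semidist A B = (SUP a\<in>A. INF b\<in>B. ennreal (dist a b))"

definition global_solution ::
    "('a::real_normed_vector \<Rightarrow> 'a) \<Rightarrow> 'a \<Rightarrow> (real \<Rightarrow> 'a) \<Rightarrow> bool"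
  where "global_solution F y \<phi> \<longleftrightarrow>
    \<phi> 0 = y \<and> (\<forall>t\<ge>0. (\<phi> has_vector_derivative F (\<phi> t)) (at t within {0..}))"

definition euler_solution ::
    "('a::real_normed_vector \<Rightarrow> 'a) \<Rightarrow> real \<Rightarrow> 'a set \<Rightarrow> 'a \<Rightarrow> (nat \<Rightarrow> 'a) \<Rightarrow> bool"
  where "euler_solution F \<epsilon> B y \<psi> \<longleftrightarrow>
    \<psi> 0 = y \<and> (\<forall>n. \<psi> n \<in> B) \<and> (\<forall>n. \<psi> (Suc n) = \<psi> n + \<epsilon> *\<^sub>R F (\<psi> (Suc n)))"

definition is_global_attractor ::
    "(real \<Rightarrow> 'a \<Rightarrow> 'a) \<Rightarrow> 'a::real_normed_vector set \<Rightarrow> bool"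
  where "is_global_attractor u A \<longleftrightarrow>
    compact A \<and> (\<forall>t\<ge>0. u t ` A = A) \<and>
    (\<forall>r>0. ((\<lambda>t. hausdorff_semidist (u t ` cball 0 r) A) \<longlongrightarrow> 0) at_top)"

definition is_numerical_attractor ::
    "(nat \<Rightarrow> 'a \<Rightarrow> 'a) \<Rightarrow> 'a set \<Rightarrow> 'a::real_normed_vector set \<Rightarrow> bool"
  where "is_numerical_attractor S B A \<longleftrightarrow>
    compact A \<and> A \<subseteq> B \<and> (\<forall>n. S n ` A = A) \<and>
    (\<lambda>n. hausdorff_semidist (S n ` B) A) \<longlonglongrightarrow> 0"

end

theory Submission
  imports Defs
begin

text \<open>
  Both limits rest on one principle. Let \<open>P\<close> be a map, \<open>A\<close> a set that \<open>P\<close> maps onto itself,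
  \<open>Q\<close> a map that sends a ball containing \<open>A\<close> to within \<open>e\<close> of a set \<open>C\<close>, and suppose that \<open>P\<close>
  and \<open>Q\<close> differ by at most \<open>\<delta>\<close> on that ball. Then every point of \<open>A\<close> is \<open>P b\<close> for some \<open>b \<in> A\<close>,
  it lies within \<open>\<delta>\<close> of \<open>Q b\<close>, and hence within \<open>\<delta> + e\<close> of \<open>C\<close>. Upper semicontinuity of
  attractors therefore needs only an attraction time for the limiting dynamics and convergence of
  the approximating dynamics over a \<^emph>\<open>bounded\<close> time, uniformly in the initial value
  (\<open>hausdorff_semidist_le_via\<close>).

  For \<open>\<epsilon> \<rightarrow> 0\<close>, \<open>Q\<close> is the flow at a time \<open>n \<epsilon>\<close> past the attraction time and \<open>P\<close> is \<open>n\<close> Euler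
  steps. The difference of the two is \<open>O(\<epsilon>)\<close> by a Gronwall argument
  (\<open>implicit_euler_error\<close>). The vector field is only locally Lipschitz, so that one must know that
  the flow stays bounded; this is inherited from the scheme. The
  Euler iterates stay in the ball of radius \<open>r\<^sup>*\<close>, and as long as the error is at most \<open>1\<close>, the
  flow stays in the ball of radius \<open>r\<^sup>* + 1\<close>, where a Lipschitz constant is available; the bound
  obtained there is below \<open>1\<close> for small \<open>\<epsilon>\<close>, so that the error never reaches \<open>1\<close>.

  For \<open>\<epsilon> \<rightarrow> \<epsilon>\<^sub>0 > 0\<close>, \<open>Q\<close> and \<open>P\<close> are the same number of Euler steps of sizes \<open>\<epsilon>\<^sub>0\<close> and \<open>\<epsilon>\<close>. The
  definition of \<open>\<epsilon>\<^sup>*\<close> gives \<open>\<epsilon>\<^sub>0 L < 1\<close>, so that \<open>id - \<epsilon>\<^sub>0 F\<close> has a Lipschitz inverse and the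
  difference is \<open>O(\<bar>\<epsilon> - \<epsilon>\<^sub>0\<bar>)\<close> after any fixed number of steps
  (\<open>implicit_euler_step_size_perturbation\<close>).

  Both error estimates hold for every locally Lipschitz vector field on a normed space. What is
  particular to the lattice system is the Lipschitz constant of its vector field on balls
  (\<open>vector_field_lipschitz\<close>).
\<close>

section \<open>Flow against implicit Euler scheme\<close>

text \<open>At the first time \<open>t\<close> at which \<open>norm (d t) = h t\<close>, the derivative bound has been in force on
  all of \<open>(a, t)\<close>, so that \<open>norm \<circ> d\<close> has grown by at most \<open>h t - h a\<close> and is still strictly below
  \<open>h t\<close>. The bound on \<open>d'\<close> is thus required only where the conclusion holds, which
  is what allows \<open>d\<close> to satisfy a differential inequality valid only locally.\<close>

lemma norm_less_comparison:
  fixes d :: "real \<Rightarrow> 'a::real_normed_vector"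
  assumes ab: "a \<le> b"
    and dc: "continuous_on {a..b} d" and hc: "continuous_on {a..b} h"
    and dd: "\<And>s. a < s \<Longrightarrow> s < b \<Longrightarrow> (d has_vector_derivative d' s) (at s)"
    and hd: "\<And>s. a < s \<Longrightarrow> s < b \<Longrightarrow> (h has_vector_derivative h' s) (at s)"
    and init: "norm (d a) < h a"
    and bound: "\<And>s. a < s \<Longrightarrow> s < b \<Longrightarrow> norm (d s) < h s \<Longrightarrow> norm (d' s) \<le> h' s"
  shows "norm (d b) < h b"
proof (rule ccontr)
  assume contra: "\<not> norm (d b) < h b"
  define Z where "Z = {s \<in> {a..b}. h s \<le> norm (d s)}"
  have "closed Z"
    unfolding Z_def by (intro continuous_closed_preimage_constant continuous_on_closed_Collect_le hc
        continuous_on_norm dc closed_atLeastAtMost)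
  moreover have "bounded Z"
    by (rule bounded_subset[OF bounded_closed_interval[of a b]]) (auto simp: Z_def)
  ultimately have "compact Z" by (simp add: compact_eq_bounded_closed)
  moreover have "b \<in> Z" using contra ab by (auto simp: Z_def)
  ultimately obtain t where t: "t \<in> Z" and least: "\<And>s. s \<in> Z \<Longrightarrow> t \<le> s"
    using compact_attains_inf[of Z] by blast
  have "t \<noteq> a" using t init by (auto simp: Z_def)
  then have at: "a < t" "t \<le> b" using t by (auto simp: Z_def)
  have below: "norm (d s) < h s" if "a < s" "s < t" for s
    using least[of s] that at by (force simp: Z_def not_less)
  have "norm (d t - d a) \<le> h t - h a"
  proof (rule differentiable_bound_general[OF \<open>a < t\<close>])
    show "continuous_on {a..t} d" "continuous_on {a..t} h"
      using dc hc at by (auto intro: continuous_on_subset)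
  qed (use at below in \<open>auto intro: dd hd bound\<close>)
  then have "norm (d t) < h t"
    using norm_triangle_sub[of "d t" "d a"] init by linarith
  then show False using t by (simp add: Z_def)
qed

text \<open>The flow is compared with the affine interpolation \<open>w\<close> of the step from \<open>x\<close> to \<open>z\<close>, which
  stays in the ball by convexity. Inside the larger ball,
  \<open>norm (\<phi> - w)' = norm (F \<phi> - F z) \<le> L * (norm (\<phi> - w) + M * \<epsilon>)\<close>,
  and \<open>h s = K * exp (L * s) - M * \<epsilon>\<close> solves the corresponding equation \<open>h' = L * (h + M * \<epsilon>)\<close>.
  Since \<open>h\<close> is a function of absolute time, the bounds of consecutive steps fit together.\<close>

lemma implicit_euler_step_error:
  fixes F :: "'a::real_normed_vector \<Rightarrow> 'a"
  assumes lip: "L-lipschitz_on (cball 0 (R + 1)) F"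
    and sol: "global_solution F y \<phi>"
    and eps: "0 < \<epsilon>" and t: "0 \<le> t" and K: "0 \<le> K"
    and x: "x \<in> cball 0 R" and z: "z \<in> cball 0 R" and step: "z = x + \<epsilon> *\<^sub>R F z"
    and M: "norm (F z) \<le> M"
    and init: "norm (\<phi> t - x) < K * exp (L * t) - M * \<epsilon>"
    and small: "K * exp (L * (t + \<epsilon>)) - M * \<epsilon> \<le> 1"
  shows "norm (\<phi> (t + \<epsilon>) - z) < K * exp (L * (t + \<epsilon>)) - M * \<epsilon>"
proof -
  have L: "0 \<le> L" using lipschitz_on_nonneg[OF lip] .
  define w where "w s = x + (s - t) *\<^sub>R F z" for s
  define h where "h s = K * exp (L * s) - M * \<epsilon>" for s
  have \<phi>d: "(\<phi> has_vector_derivative F (\<phi> s)) (at s)" if "0 < s" for s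
  proof -
    have "(\<phi> has_vector_derivative F (\<phi> s)) (at s within {0..})"
      using sol that by (simp add: global_solution_def)
    then show ?thesis using that by (simp add: at_within_interior[of s "{0..}"])
  qed
  have "continuous_on {0..} \<phi>"
    using sol unfolding global_solution_def
    by (auto simp: continuous_on_eq_continuous_within intro: has_vector_derivative_continuous)
  then have \<phi>c: "continuous_on {t..t + \<epsilon>} \<phi>"
    by (rule continuous_on_subset) (use t in auto)
  have w_ball: "w s \<in> cball 0 R" if "t < s" "s < t + \<epsilon>" for s
  proof -
    have "w s = (1 - (s - t) / \<epsilon>) *\<^sub>R x + ((s - t) / \<epsilon>) *\<^sub>R (x + \<epsilon> *\<^sub>R F z)"
      using eps by (simp add: w_def scaleR_add_right scaleR_diff_left)
    then have "w s = (1 - (s - t) / \<epsilon>) *\<^sub>R x + ((s - t) / \<epsilon>) *\<^sub>R z"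
      using step by simp
    moreover have "0 \<le> (s - t) / \<epsilon>" "(s - t) / \<epsilon> \<le> 1" using that eps by auto
    ultimately show ?thesis
      using convexD_alt[OF convex_cball x z] by metis
  qed
  have "norm (\<phi> (t + \<epsilon>) - w (t + \<epsilon>)) < h (t + \<epsilon>)"
  proof (rule norm_less_comparison[where d = "\<lambda>s. \<phi> s - w s" and d' = "\<lambda>s. F (\<phi> s) - F z"
        and h' = "\<lambda>s. L * K * exp (L * s)" and a = t])
    show "continuous_on {t..t + \<epsilon>} (\<lambda>s. \<phi> s - w s)" "continuous_on {t..t + \<epsilon>} h"
      unfolding w_def h_def by (intro continuous_intros \<phi>c)+
    show "norm (\<phi> t - w t) < h t" using init by (simp add: w_def h_def)
    fix s assume s: "t < s" "s < t + \<epsilon>"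
    show "((\<lambda>s. \<phi> s - w s) has_vector_derivative F (\<phi> s) - F z) (at s)"
      unfolding w_def using s t by (auto intro!: derivative_eq_intros \<phi>d)
    show "(h has_vector_derivative L * K * exp (L * s)) (at s)"
      unfolding h_def has_real_derivative_iff_has_vector_derivative[symmetric]
      by (auto intro!: derivative_eq_intros)
    assume d: "norm (\<phi> s - w s) < h s"
    \<comment> \<open>\<open>h\<close> is increasing, so that its bound at the end of the step holds throughout.\<close>
    have "h s \<le> 1"
      using small mult_left_mono[OF s(2)[THEN less_imp_le] L] K
      by (simp add: h_def) (smt (verit) exp_le_cancel_iff mult_left_mono)
    then have "norm (\<phi> s) \<le> R + 1"
      using d w_ball[OF s] norm_triangle_sub[of "\<phi> s" "w s"] by simp
    then have "norm (F (\<phi> s) - F z) \<le> L * norm (\<phi> s - z)"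
      using lipschitz_onD[OF lip, of "\<phi> s" z] z by (simp add: dist_norm)
    also have "norm (\<phi> s - z) \<le> norm (\<phi> s - w s) + norm (w s - z)"
      using norm_triangle_ineq[of "\<phi> s - w s" "w s - z"] by simp
    also have "norm (w s - z) \<le> \<epsilon> * M"
    proof -
      have "w s - z = w s - (x + \<epsilon> *\<^sub>R F z)" using step by simp
      also have "\<dots> = (s - t - \<epsilon>) *\<^sub>R F z" by (simp add: w_def algebra_simps)
      finally have "norm (w s - z) = \<bar>s - t - \<epsilon>\<bar> * norm (F z)" by simp
      also have "\<dots> \<le> \<epsilon> * M"
        using s eps M by (intro mult_mono) auto
      finally show ?thesis .
    qed
    finally have "norm (F (\<phi> s) - F z) \<le> L * (norm (\<phi> s - w s) + \<epsilon> * M)"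
      using L by (simp add: mult_left_mono)
    also have "\<dots> \<le> L * (h s + \<epsilon> * M)"
      using d L by (intro mult_left_mono) auto
    finally show "norm (F (\<phi> s) - F z) \<le> L * K * exp (L * s)"
      by (simp add: h_def algebra_simps)
  qed (use eps in auto)
  moreover have "w (t + \<epsilon>) = z" using step by (simp add: w_def)
  ultimately show ?thesis by (simp add: h_def)
qed

text \<open>The comparison function \<open>K * exp (L * s) - M * \<epsilon>\<close> has to be strictly positive at time \<open>0\<close>,
  where the error vanishes; \<open>K = (1 + M) * \<epsilon>\<close> gives it the value \<open>\<epsilon>\<close> there. The hypothesis
  \<open>small\<close> keeps the flow in the ball on which \<open>F\<close> is Lipschitz.\<close>

lemma implicit_euler_error:
  fixes F :: "'a::real_normed_vector \<Rightarrow> 'a"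
  assumes lip: "L-lipschitz_on (cball 0 (R + 1)) F"
    and sol: "global_solution F y \<phi>"
    and euler: "euler_solution F \<epsilon> (cball 0 R) y \<psi>"
    and eps: "0 < \<epsilon>" and M: "\<And>v. v \<in> cball 0 R \<Longrightarrow> norm (F v) \<le> M" and M0: "0 \<le> M"
    and small: "(1 + M) * \<epsilon> * exp (L * (real n * \<epsilon>)) \<le> 1"
  shows "norm (\<phi> (real n * \<epsilon>) - \<psi> n) \<le> (1 + M) * \<epsilon> * exp (L * (real n * \<epsilon>))"
proof -
  have L: "0 \<le> L" using lipschitz_on_nonneg[OF lip] .
  define K where "K = (1 + M) * \<epsilon>"
  have K: "0 \<le> K" using M0 eps by (simp add: K_def)
  have \<psi>: "\<psi> 0 = y" "\<And>m. \<psi> m \<in> cball 0 R" "\<And>m. \<psi> (Suc m) = \<psi> m + \<epsilon> *\<^sub>R F (\<psi> (Suc m))"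
    using euler by (auto simp: euler_solution_def)
  have "norm (\<phi> (real m * \<epsilon>) - \<psi> m) < K * exp (L * (real m * \<epsilon>)) - M * \<epsilon>" if "m \<le> n" for m
    using that
  proof (induction m)
    case 0
    then show ?case
      using sol eps \<psi>(1) by (simp add: global_solution_def K_def algebra_simps)
  next
    case (Suc m)
    have "real (Suc m) * \<epsilon> \<le> real n * \<epsilon>"
      using Suc.prems eps by (intro mult_right_mono) auto
    then have "K * exp (L * (real (Suc m) * \<epsilon>)) \<le> K * exp (L * (real n * \<epsilon>))"
      using K L by (intro mult_left_mono) (simp_all add: mult_left_mono)
    also have "\<dots> \<le> 1" using small by (simp add: K_def)
    finally have "K * exp (L * (real m * \<epsilon> + \<epsilon>)) - M * \<epsilon> \<le> 1"
      using M0 eps by (simp add: algebra_simps) (smt (verit) mult_nonneg_nonneg)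
    moreover have "norm (\<phi> (real m * \<epsilon>) - \<psi> m) < K * exp (L * (real m * \<epsilon>)) - M * \<epsilon>"
      using Suc by simp
    ultimately have "norm (\<phi> (real m * \<epsilon> + \<epsilon>) - \<psi> (Suc m))
        < K * exp (L * (real m * \<epsilon> + \<epsilon>)) - M * \<epsilon>"
      using implicit_euler_step_error[OF lip sol eps _ K \<psi>(2) \<psi>(2) \<psi>(3) M[OF \<psi>(2)]] eps by simp
    then show ?case by (simp add: algebra_simps)
  qed
  from this[of n] show ?thesis
    using M0 eps unfolding K_def[symmetric] by (smt (verit) mult_nonneg_nonneg order_refl)
qed

lemma lipschitz_on_cball_norm_le:
  fixes F :: "'a::real_normed_vector \<Rightarrow> 'b::real_normed_vector"
  assumes lip: "L-lipschitz_on (cball 0 R) F" and v: "v \<in> cball 0 R"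
  shows "norm (F v) \<le> norm (F 0) + L * R"
proof -
  have "0 \<in> cball 0 R" using v order_trans[OF norm_ge_zero, of v R] by simp
  then have "norm (F v - F 0) \<le> L * norm v"
    using lipschitz_onD[OF lip v, of 0] by (simp add: dist_norm)
  also have "\<dots> \<le> L * R"
    using v lipschitz_on_nonneg[OF lip] by (intro mult_left_mono) auto
  finally show ?thesis using norm_triangle_sub[of "F v" "F 0"] by simp
qed

section \<open>Convergence of attractors\<close>

lemma hausdorff_semidist_le_via:
  assumes near: "\<And>a. a \<in> A \<Longrightarrow> \<exists>x\<in>X. dist a x \<le> \<delta>"
    and X: "hausdorff_semidist X C < ennreal e"
  shows "hausdorff_semidist A C \<le> ennreal (\<delta> + e)"
  unfolding hausdorff_semidist_def
proof (rule SUP_least)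
  fix a assume "a \<in> A"
  then obtain x where x: "x \<in> X" "dist a x \<le> \<delta>" using near by blast
  have "(INF c\<in>C. ennreal (dist x c)) \<le> hausdorff_semidist X C"
    unfolding hausdorff_semidist_def using x(1) by (rule SUP_upper)
  then have "(INF c\<in>C. ennreal (dist x c)) < ennreal e" using X by (rule le_less_trans)
  then obtain c where c: "c \<in> C" "ennreal (dist x c) < ennreal e"
    unfolding INF_less_iff by blast
  then have "dist x c < e"
    by (simp add: ennreal_less_iff)
  then have "dist a c \<le> \<delta> + e" using dist_triangle[of a c x] x by simp
  then show "(INF c\<in>C. ennreal (dist a c)) \<le> ennreal (\<delta> + e)"
    using c(1) by (intro INF_lower2[of c] ennreal_leI)
qed

lemma tendsto_0_ennrealI:
  fixes f :: "'b \<Rightarrow> ennreal"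
  assumes "\<And>e::real. 0 < e \<Longrightarrow> eventually (\<lambda>x. f x \<le> ennreal e) G"
  shows "(f \<longlongrightarrow> 0) G"
proof (rule tendsto_zero_ennreal)
  fix r :: real assume r: "0 < r"
  have "eventually (\<lambda>x. f x \<le> ennreal (r / 2)) G" using assms[of "r / 2"] r by simp
  then show "eventually (\<lambda>x. f x < ennreal r) G"
  proof (rule eventually_mono)
    fix x assume "f x \<le> ennreal (r / 2)"
    moreover have "ennreal (r / 2) < ennreal r" using r by (simp add: ennreal_less_iff)
    ultimately show "f x < ennreal r" by (rule le_less_trans)
  qed
qed

text \<open>The radius \<open>R + 1\<close> also serves for attraction: it is positive even if \<open>R = 0\<close>.\<close>

lemma numerical_attractor_tendsto_global_attractor:
  fixes F :: "'a::real_normed_vector \<Rightarrow> 'a"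
  assumes lip: "L-lipschitz_on (cball 0 (R + 1)) F" and R: "0 \<le> R"
    and sol: "\<And>y. global_solution F y (\<lambda>t. u t y)"
    and attr: "is_global_attractor u A"
    and eps1: "0 < \<epsilon>\<^sub>1"
    and euler: "\<And>\<epsilon> y. \<epsilon> \<in> {0<..\<epsilon>\<^sub>1} \<Longrightarrow> y \<in> cball 0 R \<Longrightarrow>
      euler_solution F \<epsilon> (cball 0 R) y (\<lambda>n. S \<epsilon> n y)"
    and num: "\<And>\<epsilon>. \<epsilon> \<in> {0<..\<epsilon>\<^sub>1} \<Longrightarrow> is_numerical_attractor (S \<epsilon>) (cball 0 R) (A_num \<epsilon>)"
  shows "((\<lambda>\<epsilon>. hausdorff_semidist (A_num \<epsilon>) A) \<longlongrightarrow> 0) (at_right 0)"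
proof (rule tendsto_0_ennrealI)
  fix e :: real assume e: "0 < e"
  have L: "0 \<le> L" using lipschitz_on_nonneg[OF lip] .
  define M where "M = norm (F 0) + L * R"
  have M0: "0 \<le> M" using L R by (simp add: M_def)
  have "L-lipschitz_on (cball 0 R) F" by (rule lipschitz_on_subset[OF lip]) auto
  note M = lipschitz_on_cball_norm_le[OF this, folded M_def]
  have "eventually (\<lambda>t. hausdorff_semidist (u t ` cball 0 (R + 1)) A < ennreal (e / 2)) at_top"
    using attr R e unfolding is_global_attractor_def by (intro order_tendstoD(2)[of _ 0]) auto
  then obtain T0 where T0:
      "\<And>t. T0 \<le> t \<Longrightarrow> hausdorff_semidist (u t ` cball 0 (R + 1)) A < ennreal (e / 2)"
    unfolding eventually_at_top_linorder by blast
  define T where "T = max T0 0"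
  define D where "D = (1 + M) * exp (L * (T + 1))"
  have D: "0 < D" using M0 by (auto simp: D_def intro!: mult_pos_pos)
  define \<epsilon>\<^sub>2 where "\<epsilon>\<^sub>2 = min (min \<epsilon>\<^sub>1 1) (min (1 / D) (e / 2 / D))"
  have "0 < \<epsilon>\<^sub>2" using eps1 D e by (simp add: \<epsilon>\<^sub>2_def)
  then have "eventually (\<lambda>\<epsilon>. \<epsilon> \<in> {0<..<\<epsilon>\<^sub>2}) (at_right 0)"
    by (rule eventually_at_right_real)
  then show "eventually (\<lambda>\<epsilon>. hausdorff_semidist (A_num \<epsilon>) A \<le> ennreal e) (at_right 0)"
  proof (rule eventually_mono)
    fix \<epsilon> assume "\<epsilon> \<in> {0<..<\<epsilon>\<^sub>2}"
    then have \<epsilon>: "0 < \<epsilon>" "\<epsilon> \<le> 1" "\<epsilon> \<in> {0<..\<epsilon>\<^sub>1}" "D * \<epsilon> \<le> 1" "D * \<epsilon> \<le> e / 2"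
      using D by (auto simp: \<epsilon>\<^sub>2_def field_simps)
    \<comment> \<open>The first step of the scheme past the attraction time, still before time \<open>T + 1\<close>.\<close>
    define n where "n = nat \<lceil>T / \<epsilon>\<rceil>"
    have "T / \<epsilon> \<le> real n" "real n \<le> T / \<epsilon> + 1"
      using of_nat_ceiling[of "T / \<epsilon>"] of_int_ceiling_le_add_one[of "T / \<epsilon>"] \<epsilon>(1)
      by (auto simp: n_def T_def)
    then have n: "T \<le> real n * \<epsilon>" "real n * \<epsilon> \<le> T + 1"
      using \<epsilon>(1,2) by (auto simp: field_simps)
    have growth: "(1 + M) * \<epsilon> * exp (L * (real n * \<epsilon>)) \<le> D * \<epsilon>"
    proof -
      have "exp (L * (real n * \<epsilon>)) \<le> exp (L * (T + 1))"
        using n(2) L by (simp add: mult_left_mono)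
      then have "(1 + M) * \<epsilon> * exp (L * (real n * \<epsilon>)) \<le> (1 + M) * \<epsilon> * exp (L * (T + 1))"
        using M0 \<epsilon>(1) by (intro mult_left_mono) auto
      then show ?thesis by (simp add: D_def mult_ac)
    qed
    have A\<epsilon>: "A_num \<epsilon> \<subseteq> cball 0 R" "S \<epsilon> n ` A_num \<epsilon> = A_num \<epsilon>"
      using num[OF \<epsilon>(3)] by (auto simp: is_numerical_attractor_def)
    have "hausdorff_semidist (A_num \<epsilon>) A \<le> ennreal (e / 2 + e / 2)"
    proof (rule hausdorff_semidist_le_via)
      show "hausdorff_semidist (u (real n * \<epsilon>) ` cball 0 (R + 1)) A < ennreal (e / 2)"
        using n by (intro T0) (simp add: T_def)
      fix a assume "a \<in> A_num \<epsilon>"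
      then obtain b where b: "b \<in> A_num \<epsilon>" "a = S \<epsilon> n b" using A\<epsilon>(2) by blast
      then have bR: "b \<in> cball 0 R" using A\<epsilon>(1) by blast
      have "norm (u (real n * \<epsilon>) b - S \<epsilon> n b) \<le> (1 + M) * \<epsilon> * exp (L * (real n * \<epsilon>))"
        using implicit_euler_error[OF lip sol euler[OF \<epsilon>(3) bR] \<epsilon>(1) M M0] growth \<epsilon>(4) by simp
      also have "\<dots> \<le> e / 2" using growth \<epsilon>(5) by simp
      finally have "dist a (u (real n * \<epsilon>) b) \<le> e / 2"
        by (simp add: b(2) dist_norm norm_minus_commute)
      then show "\<exists>x\<in>u (real n * \<epsilon>) ` cball 0 (R + 1). dist a x \<le> e / 2"
        using bR by auto
    qed
    then show "hausdorff_semidist (A_num \<epsilon>) A \<le> ennreal e" by simp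
  qed
qed

text \<open>Subtracting one step of size \<open>\<epsilon>\<^sub>0\<close> from one of size \<open>\<epsilon>\<close> gives, with errors \<open>e\<^sub>n\<close>,
  \<open>e\<^sub>n\<^sub>+\<^sub>1 \<le> e\<^sub>n + \<epsilon>\<^sub>0 * L * e\<^sub>n\<^sub>+\<^sub>1 + \<bar>\<epsilon> - \<epsilon>\<^sub>0\<bar> * M\<close>. The Lipschitz term carries the factor \<open>\<epsilon>\<^sub>0\<close> and not
  \<open>\<epsilon>\<close>, so that it can be absorbed on the left with a constant uniform in \<open>\<epsilon>\<close>.\<close>

lemma implicit_euler_step_size_perturbation:
  fixes F :: "'a::real_normed_vector \<Rightarrow> 'a"
  assumes lip: "L-lipschitz_on (cball 0 R) F" and "0 \<le> \<epsilon>\<^sub>0" and contr: "\<epsilon>\<^sub>0 * L < 1"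
  obtains D where "0 \<le> D" "\<And>\<epsilon> y \<phi> \<psi>. euler_solution F \<epsilon> (cball 0 R) y \<phi> \<Longrightarrow>
      euler_solution F \<epsilon>\<^sub>0 (cball 0 R) y \<psi> \<Longrightarrow> norm (\<phi> n - \<psi> n) \<le> D * \<bar>\<epsilon> - \<epsilon>\<^sub>0\<bar>"
proof -
  define M where "M = norm (F 0) + L * R"
  note M = lipschitz_on_cball_norm_le[OF lip, folded M_def]
  have "\<exists>D\<ge>0. \<forall>\<epsilon> y \<phi> \<psi>. euler_solution F \<epsilon> (cball 0 R) y \<phi> \<longrightarrow>
      euler_solution F \<epsilon>\<^sub>0 (cball 0 R) y \<psi> \<longrightarrow> norm (\<phi> n - \<psi> n) \<le> D * \<bar>\<epsilon> - \<epsilon>\<^sub>0\<bar>"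
  proof (induction n)
    case 0
    then show ?case by (intro exI[of _ 0]) (auto simp: euler_solution_def)
  next
    case (Suc n)
    then obtain D where D: "0 \<le> D" "\<And>\<epsilon> y \<phi> \<psi>. euler_solution F \<epsilon> (cball 0 R) y \<phi> \<Longrightarrow>
      euler_solution F \<epsilon>\<^sub>0 (cball 0 R) y \<psi> \<Longrightarrow> norm (\<phi> n - \<psi> n) \<le> D * \<bar>\<epsilon> - \<epsilon>\<^sub>0\<bar>"
      by blast
    define q where "q = 1 - \<epsilon>\<^sub>0 * L"
    have q: "0 < q" using contr by (simp add: q_def)
    have "norm (\<phi> (Suc n) - \<psi> (Suc n)) \<le> (D + \<bar>M\<bar>) / q * \<bar>\<epsilon> - \<epsilon>\<^sub>0\<bar>"
      if \<phi>: "euler_solution F \<epsilon> (cball 0 R) y \<phi>" and \<psi>: "euler_solution F \<epsilon>\<^sub>0 (cball 0 R) y \<psi>"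
      for \<epsilon> y \<phi> \<psi>
    proof -
      let ?v = "\<phi> (Suc n)" and ?w = "\<psi> (Suc n)"
      have balls: "?v \<in> cball 0 R" "?w \<in> cball 0 R"
        using \<phi> \<psi> unfolding euler_solution_def by blast+
      have v: "?v = \<phi> n + \<epsilon> *\<^sub>R F ?v" and w: "?w = \<psi> n + \<epsilon>\<^sub>0 *\<^sub>R F ?w"
        using \<phi> \<psi> unfolding euler_solution_def by blast+
      have "?v - ?w = (\<phi> n + \<epsilon> *\<^sub>R F ?v) - (\<psi> n + \<epsilon>\<^sub>0 *\<^sub>R F ?w)"
        using v w by argo
      also have "\<dots> = (\<phi> n - \<psi> n) + \<epsilon>\<^sub>0 *\<^sub>R (F ?v - F ?w) + (\<epsilon> - \<epsilon>\<^sub>0) *\<^sub>R F ?v"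
        by (simp add: algebra_simps)
      finally have "norm (?v - ?w)
          \<le> norm (\<phi> n - \<psi> n) + norm (\<epsilon>\<^sub>0 *\<^sub>R (F ?v - F ?w)) + norm ((\<epsilon> - \<epsilon>\<^sub>0) *\<^sub>R F ?v)"
        by (metis norm_triangle_le add_right_mono norm_triangle_ineq)
      also have "norm (\<phi> n - \<psi> n) \<le> D * \<bar>\<epsilon> - \<epsilon>\<^sub>0\<bar>" by (rule D(2)[OF \<phi> \<psi>])
      also have "norm (\<epsilon>\<^sub>0 *\<^sub>R (F ?v - F ?w)) \<le> \<epsilon>\<^sub>0 * (L * norm (?v - ?w))"
        using lipschitz_onD[OF lip balls] \<open>0 \<le> \<epsilon>\<^sub>0\<close> by (simp add: dist_norm mult_left_mono)
      also have "norm ((\<epsilon> - \<epsilon>\<^sub>0) *\<^sub>R F ?v) \<le> \<bar>\<epsilon> - \<epsilon>\<^sub>0\<bar> * \<bar>M\<bar>"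
        using M[OF balls(1)] by (simp add: mult_left_mono)
      finally have "q * norm (?v - ?w) \<le> (D + \<bar>M\<bar>) * \<bar>\<epsilon> - \<epsilon>\<^sub>0\<bar>"
        by (simp add: q_def algebra_simps)
      then show ?thesis using q by (simp add: field_simps)
    qed
    moreover have "0 \<le> (D + \<bar>M\<bar>) / q" using D(1) q by simp
    ultimately show ?case by blast
  qed
  then show ?thesis using that by blast
qed

lemma numerical_attractor_upper_semicontinuous:
  fixes F :: "'a::real_normed_vector \<Rightarrow> 'a"
  assumes lip: "L-lipschitz_on (cball 0 R) F"
    and I: "\<epsilon>\<^sub>0 \<in> I" and "0 \<le> \<epsilon>\<^sub>0" and contr: "\<epsilon>\<^sub>0 * L < 1"
    and euler: "\<And>\<epsilon> y. \<epsilon> \<in> I \<Longrightarrow> y \<in> cball 0 R \<Longrightarrow>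
      euler_solution F \<epsilon> (cball 0 R) y (\<lambda>n. S \<epsilon> n y)"
    and num: "\<And>\<epsilon>. \<epsilon> \<in> I \<Longrightarrow> is_numerical_attractor (S \<epsilon>) (cball 0 R) (A_num \<epsilon>)"
  shows "((\<lambda>\<epsilon>. hausdorff_semidist (A_num \<epsilon>) (A_num \<epsilon>\<^sub>0)) \<longlongrightarrow> 0) (at \<epsilon>\<^sub>0 within I)"
proof (rule tendsto_0_ennrealI)
  fix e :: real assume e: "0 < e"
  have "eventually (\<lambda>n. hausdorff_semidist (S \<epsilon>\<^sub>0 n ` cball 0 R) (A_num \<epsilon>\<^sub>0) < ennreal (e / 2))
      sequentially"
    using num[OF I] e unfolding is_numerical_attractor_def by (intro order_tendstoD(2)[of _ 0]) auto
  then obtain n where n: "hausdorff_semidist (S \<epsilon>\<^sub>0 n ` cball 0 R) (A_num \<epsilon>\<^sub>0) < ennreal (e / 2)"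
    unfolding eventually_sequentially by blast
  obtain D where D: "0 \<le> D" "\<And>\<epsilon> y \<phi> \<psi>. euler_solution F \<epsilon> (cball 0 R) y \<phi> \<Longrightarrow>
      euler_solution F \<epsilon>\<^sub>0 (cball 0 R) y \<psi> \<Longrightarrow> norm (\<phi> n - \<psi> n) \<le> D * \<bar>\<epsilon> - \<epsilon>\<^sub>0\<bar>"
    using implicit_euler_step_size_perturbation[OF lip \<open>0 \<le> \<epsilon>\<^sub>0\<close> contr] by blast
  have "((\<lambda>\<epsilon>. D * \<bar>\<epsilon> - \<epsilon>\<^sub>0\<bar>) \<longlongrightarrow> D * \<bar>\<epsilon>\<^sub>0 - \<epsilon>\<^sub>0\<bar>) (at \<epsilon>\<^sub>0 within I)"
    by (intro tendsto_intros)
  then have "eventually (\<lambda>\<epsilon>. D * \<bar>\<epsilon> - \<epsilon>\<^sub>0\<bar> < e / 2) (at \<epsilon>\<^sub>0 within I)"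
    by (rule order_tendstoD) (use e in simp)
  moreover have "eventually (\<lambda>\<epsilon>. \<epsilon> \<in> I) (at \<epsilon>\<^sub>0 within I)"
    by (simp add: eventually_at_filter)
  ultimately show "eventually (\<lambda>\<epsilon>. hausdorff_semidist (A_num \<epsilon>) (A_num \<epsilon>\<^sub>0) \<le> ennreal e)
      (at \<epsilon>\<^sub>0 within I)"
  proof eventually_elim
    fix \<epsilon> assume close: "D * \<bar>\<epsilon> - \<epsilon>\<^sub>0\<bar> < e / 2" and \<epsilon>: "\<epsilon> \<in> I"
    have A\<epsilon>: "A_num \<epsilon> \<subseteq> cball 0 R" "S \<epsilon> n ` A_num \<epsilon> = A_num \<epsilon>"
      using num[OF \<epsilon>] by (auto simp: is_numerical_attractor_def)
    have "hausdorff_semidist (A_num \<epsilon>) (A_num \<epsilon>\<^sub>0) \<le> ennreal (e / 2 + e / 2)"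
    proof (rule hausdorff_semidist_le_via[OF _ n])
      fix a assume "a \<in> A_num \<epsilon>"
      then obtain b where b: "b \<in> A_num \<epsilon>" "a = S \<epsilon> n b" using A\<epsilon>(2) by blast
      then have bR: "b \<in> cball 0 R" using A\<epsilon>(1) by blast
      have "dist a (S \<epsilon>\<^sub>0 n b) \<le> e / 2"
        using D(2)[OF euler[OF \<epsilon> bR] euler[OF I bR]] close by (simp add: b(2) dist_norm)
      then show "\<exists>x\<in>S \<epsilon>\<^sub>0 n ` cball 0 R. dist a x \<le> e / 2" using bR by blast
    qed
    then show "hausdorff_semidist (A_num \<epsilon>) (A_num \<epsilon>\<^sub>0) \<le> ennreal e" by simp
  qed
qed

section \<open>The Lipschitz constant of the lattice vector field\<close>

lemma norm_coord_shift:
  assumes "\<And>j. coord v j = coord u (j + m)"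
  shows "norm v = norm (u :: ell2)"
proof -
  have "bij_betw (\<lambda>j::int. j + m) UNIV UNIV"
    by (rule bij_betwI[of _ _ _ "\<lambda>j. j - m"]) auto
  from infsum_reindex_bij_betw[OF this, of "\<lambda>j. (cmod (coord u j))\<^sup>2"]
  show ?thesis by (simp add: norm_ell2_def assms)
qed

lemma coord_Abs_shift: "coord (Abs_ell2 (\<lambda>j. coord u (j + m))) j = coord u (j + m)"
  using coord_Abs_ell2[OF square_summable_shift[OF coord_summable]] by simp

text \<open>The operator is \<open>2 * id\<close> minus the two unit shifts, which are isometries.\<close>

lemma norm_lattice_op_le: "norm (lattice_op u) \<le> 4 * norm u"
proof -
  define v where "v m = Abs_ell2 (\<lambda>j. coord u (j + m))" for m
  have v: "coord (v m) j = coord u (j + m)" for m j by (simp add: v_def coord_Abs_shift)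
  have "lattice_op u = 2 *\<^sub>R u - (v (-1) + v 1)"
    by (rule ell2_eqI) (simp add: coord_lattice_op v)
  then have "norm (lattice_op u) \<le> norm (2 *\<^sub>R u) + (norm (v (-1)) + norm (v 1))"
    by (metis norm_triangle_le_diff norm_triangle_ineq add_left_mono order_refl)
  then show ?thesis by (simp add: norm_coord_shift[OF v])
qed

lemma lattice_op_diff: "lattice_op u - lattice_op v = lattice_op (u - v)"
  by (rule ell2_eqI) (simp add: coord_lattice_op algebra_simps)

lemma norm_scaleC: "norm (c *\<^sub>C u) = cmod c * norm u"
  by (simp add: norm_ell2_def norm_mult power_mult_distrib infsum_cmult_right' real_sqrt_mult)

lemma scaleC_diff: "c *\<^sub>C u - c *\<^sub>C v = c *\<^sub>C (u - v)"
  by (rule ell2_eqI) (simp add: algebra_simps)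

lemma vector_field_lipschitz:
  assumes "0 \<le> l" "0 \<le> \<gamma>" "0 \<le> k" "0 \<le> Cp"
    and nl: "\<And>v w. v \<in> cball 0 r \<Longrightarrow> w \<in> cball 0 r \<Longrightarrow>
      norm (power_nl p v - power_nl p w) \<le> Cp * r powr p * norm (v - w)"
  shows "(L_const l \<mu> \<gamma> \<beta> k \<nu> p Cp r)-lipschitz_on (cball 0 r) (vector_field l \<mu> \<gamma> \<beta> k \<nu> p g)"
proof (rule lipschitz_onI)
  fix v w :: ell2 assume vw: "v \<in> cball 0 r" "w \<in> cball 0 r"
  let ?F = "vector_field l \<mu> \<gamma> \<beta> k \<nu> p g"
  have "?F v - ?F w = Complex l \<mu> *\<^sub>C (lattice_op v - lattice_op w) - Complex \<gamma> \<beta> *\<^sub>C (v - w)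
      - Complex k \<nu> *\<^sub>C (power_nl p v - power_nl p w)"
    by (simp add: vector_field_def scaleC_diff[symmetric] algebra_simps)
  then have "norm (?F v - ?F w) \<le> norm (Complex l \<mu> *\<^sub>C (lattice_op v - lattice_op w))
      + norm (Complex \<gamma> \<beta> *\<^sub>C (v - w)) + norm (Complex k \<nu> *\<^sub>C (power_nl p v - power_nl p w))"
    by (metis norm_triangle_ineq4 norm_triangle_le_diff add_right_mono)
  also have "\<dots> \<le> (l + \<bar>\<mu>\<bar>) * (4 * norm (v - w)) + (\<gamma> + \<bar>\<beta>\<bar>) * norm (v - w)
      + (k + \<bar>\<nu>\<bar>) * (Cp * r powr p * norm (v - w))"
  proof -
    have c: "cmod (Complex a b) \<le> a + \<bar>b\<bar>" if "0 \<le> a" for a b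
      using cmod_le[of "Complex a b"] that by simp
    show ?thesis
      unfolding norm_scaleC lattice_op_diff
      by (intro add_mono mult_mono c nl vw norm_lattice_op_le order_refl)
        (use assms(1-4) in auto)
  qed
  finally show "dist (?F v) (?F w) \<le> L_const l \<mu> \<gamma> \<beta> k \<nu> p Cp r * dist v w"
    by (simp add: L_const_def dist_norm algebra_simps)
qed (use assms in \<open>auto simp: L_const_def\<close>)

section \<open>The lattice system\<close>

lemma c1_const_nonneg: "0 \<le> p \<Longrightarrow> 0 \<le> c1_const k p g"
  by (simp add: c1_const_def)

theorem theorem3p3:
  fixes l \<mu> \<gamma> \<beta> k \<nu> p Cp \<eta> :: real and g :: ell2
    and u :: "real \<Rightarrow> ell2 \<Rightarrow> ell2" and S :: "real \<Rightarrow> nat \<Rightarrow> ell2 \<Rightarrow> ell2"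
    and A :: "ell2 set" and A_num :: "real \<Rightarrow> ell2 set"
  defines "F \<equiv> vector_field l \<mu> \<gamma> \<beta> k \<nu> p g"
    and "B \<equiv> cball 0 (r_star l \<gamma> k p g \<eta>)"
    and "\<epsilon>s \<equiv> eps_star l \<mu> \<gamma> \<beta> k \<nu> p g Cp \<eta>"
  assumes "l > 0" "\<gamma> > 0" "k > 0" "p > 0" "\<gamma> > 4 * l" "\<eta> \<ge> 0"
    and "q_summable ((p + 2) / (p + 1)) g"
    and "Cp > 0"
    and "\<And>r v w. r > 0 \<Longrightarrow> v \<in> cball 0 r \<Longrightarrow> w \<in> cball 0 r \<Longrightarrow>
      norm (power_nl p v - power_nl p w) \<le> Cp * r powr p * norm (v - w)"
    and "\<And>y. global_solution F y (\<lambda>t. u t y)"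
    and "is_global_attractor u A"
    and "\<And>\<epsilon> y. \<epsilon> \<in> {0<..\<epsilon>s} \<Longrightarrow> y \<in> B \<Longrightarrow> euler_solution F \<epsilon> B y (\<lambda>n. S \<epsilon> n y)"
    and "\<And>\<epsilon>. \<epsilon> \<in> {0<..\<epsilon>s} \<Longrightarrow> is_numerical_attractor (S \<epsilon>) B (A_num \<epsilon>)"
  shows "((\<lambda>\<epsilon>. hausdorff_semidist (A_num \<epsilon>) A) \<longlongrightarrow> 0) (at_right 0)
    \<and> (\<forall>\<epsilon>\<^sub>0\<in>{0<..\<epsilon>s}.
        ((\<lambda>\<epsilon>. hausdorff_semidist (A_num \<epsilon>) (A_num \<epsilon>\<^sub>0)) \<longlongrightarrow> 0) (at \<epsilon>\<^sub>0 within {0<..\<epsilon>s}))"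
proof -
  define R where "R = r_star l \<gamma> k p g \<eta>"
  define L where "L = L_const l \<mu> \<gamma> \<beta> k \<nu> p Cp (R + 1)"
  have R: "0 \<le> R"
    using c1_const_nonneg[of p k g] assms(4-9) by (simp add: R_def r_star_def)
  have B: "B = cball 0 R" by (simp add: B_def R_def)
  have lip: "L-lipschitz_on (cball 0 (R + 1)) F"
    unfolding F_def L_def using R assms(4-7,11,12) by (intro vector_field_lipschitz) auto
  have lipR: "L-lipschitz_on (cball 0 R) F"
    by (rule lipschitz_on_subset[OF lip]) auto
  have L: "0 \<le> L" using lipschitz_on_nonneg[OF lip] .
  have "0 < (4 * l + 4 * \<bar>\<mu>\<bar> + \<gamma> + \<bar>\<beta>\<bar>) * (R + 1)"
    using R assms(4,5) by (intro mult_pos_pos) auto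
  moreover have "0 \<le> (k + \<bar>\<nu>\<bar>) * (R + 1) powr (p + 1)" using assms(6) by simp
  ultimately have "0 < M_const l \<mu> \<gamma> \<beta> k \<nu> p g (R + 1)"
    using norm_ge_zero[of g] unfolding M_const_def by linarith
  then have \<epsilon>s: "0 < \<epsilon>s" "\<epsilon>s \<le> 1 / (1 + L)"
    using L by (auto simp: \<epsilon>s_def eps_star_def Let_def R_def[symmetric] L_def[symmetric])
  have contr: "\<epsilon> * L < 1" if "\<epsilon> \<in> {0<..\<epsilon>s}" for \<epsilon>
  proof -
    have "\<epsilon> \<le> 1 / (1 + L)" using that \<epsilon>s(2) by simp
    then have "\<epsilon> * (1 + L) \<le> 1" using L by (simp add: field_simps)
    then show ?thesis using that by (simp add: algebra_simps)
  qed
  note euler = assms(15)[unfolded B] and num = assms(16)[unfolded B]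
  show ?thesis
  proof (intro conjI ballI)
    show "((\<lambda>\<epsilon>. hausdorff_semidist (A_num \<epsilon>) A) \<longlongrightarrow> 0) (at_right 0)"
      by (rule numerical_attractor_tendsto_global_attractor[OF lip R assms(13,14) \<epsilon>s(1) euler num])
  next
    fix \<epsilon>\<^sub>0 assume \<epsilon>\<^sub>0: "\<epsilon>\<^sub>0 \<in> {0<..\<epsilon>s}"
    then have "0 \<le> \<epsilon>\<^sub>0" by simp
    from numerical_attractor_upper_semicontinuous[OF lipR \<epsilon>\<^sub>0 this contr[OF \<epsilon>\<^sub>0] euler num]
    show "((\<lambda>\<epsilon>. hausdorff_semidist (A_num \<epsilon>) (A_num \<epsilon>\<^sub>0)) \<longlongrightarrow> 0) (at \<epsilon>\<^sub>0 within {0<..\<epsilon>s})" .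
  qed
qed

end
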